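(* Let $B>0$, $\mathcal{A}=\{A_1,A_2,\ldots\}$ with $A_i>0$, and let $X_1,X_2,\ldots$ be independent real random variables with $\mathbb{E}[X_i]=0$, $\mathrm{Var}(X_i)\le A_i^2$ and $\mathbb{P}(X_i>B)=0$ for all $i\ge1$. Let $S_n=\sum_{i=1}^n X_i$. Let $\eta>1$ and let $h:[0,\infty)\to(0,\infty)$ satisfy $\sum_{k=0}^\infty 1/h(k)\le1$. Then for any $\delta\in[0,1]$, $$\mathbb{P}\left(\exists\,n\ge1:\ S_n\ge q\Big(\frac{\delta}{h(k_n)};c_n,\mathcal{A},B\Big)\right)\le\delta .$$
   Context: For each $n\ge1$, $k_n:=\min\{k\in\mathbb{Z}_{\ge0}:\lceil\eta^k\rceil\le n\le\lfloor\eta^{k+1}\rfloor\}$ and $c_n:=\lfloor\eta^{k_n+1}\rfloor$. Write $(a)_+=\max\{a,0\}$ and $(a)_+^2=((a)_+)^2$. Given $B>0$ and $A_i>0$, let $G_1,G_2,\ldots$ be independent with $\mathbb{P}(G_i=-A_i^2/B)=B^2/(A_i^2+B^2)$ and $\mathbb{P}(G_i=B)=A_i^2/(A_i^2+B^2)$. For $m\ge1$ define $$\tilde P_{2,m}(u)=\inf_{x<u}\frac{\mathbb{E}[(\sum_{i=1}^m G_i-x)_+^2]}{(u-x)_+^2},\qquad u\in\mathbb{R}.$$ For $\delta\in[0,1)$, $q(\delta;m,\mathcal{A},B)$ denotes the unique solution $u$ of $\tilde P_{2,m}(u)=\delta$ when $\delta\ge\mathbb{P}(\sum_{i=1}^m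 G_i=mB)$, and $q(\delta;m,\mathcal{A},B)=mB+1$ when $\delta<\mathbb{P}(\sum_{i=1}^m G_i=mB)$. (Note $h(k)>1$ for all integers $k\ge0$, so only arguments $<1$ occur.) *)

theory Defs
  imports "HOL-Probability.Probability"
begin

text \<open>
  Blocks of the geometric grid. For \<open>\<eta> > 1\<close> and \<open>n \<ge> 1\<close> the set minimised over is nonempty
  (take \<open>k\<close> with \<open>\<eta> ^ k \<le> n < \<eta> ^ (k + 1)\<close>), so \<open>LEAST\<close> is a genuine minimum.
\<close>

definition block_index :: "real \<Rightarrow> nat \<Rightarrow> nat" where
  "block_index \<eta> n = (LEAST k. \<lceil>\<eta> ^ k\<rceil> \<le> int n \<and> int n \<le> \<lfloor>\<eta> ^ (k + 1)\<rfloor>)"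

definition block_end :: "real \<Rightarrow> nat \<Rightarrow> nat" where
  "block_end \<eta> n = nat \<lfloor>\<eta> ^ (block_index \<eta> n + 1)\<rfloor>"

definition G_pmf :: "real \<Rightarrow> real \<Rightarrow> real pmf" where
  "G_pmf a B = map_pmf (\<lambda>b. if b then B else - a\<^sup>2 / B) (bernoulli_pmf (a\<^sup>2 / (a\<^sup>2 + B\<^sup>2)))"

lemma pmf_G_pmf:
  assumes "a > 0" "B > 0"
  shows "pmf (G_pmf a B) B = a\<^sup>2 / (a\<^sup>2 + B\<^sup>2)"
    and "pmf (G_pmf a B) (- a\<^sup>2 / B) = B\<^sup>2 / (a\<^sup>2 + B\<^sup>2)"
proof -
  have neg: "- a\<^sup>2 / B < 0"
    using assms by simp
  have pos: "0 < a\<^sup>2 + B\<^sup>2"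
    using assms by (simp add: add_pos_pos)
  then have p: "0 \<le> a\<^sup>2 / (a\<^sup>2 + B\<^sup>2)" "a\<^sup>2 / (a\<^sup>2 + B\<^sup>2) \<le> 1"
    by (simp_all add: pos_divide_le_eq)
  have "(\<lambda>b. if b then B else - a\<^sup>2 / B) -` {B} = {True}"
    and "(\<lambda>b. if b then B else - a\<^sup>2 / B) -` {- a\<^sup>2 / B} = {False}"
    using neg assms(2) by (auto split: if_splits)
  moreover have "1 - a\<^sup>2 / (a\<^sup>2 + B\<^sup>2) = B\<^sup>2 / (a\<^sup>2 + B\<^sup>2)"
    using pos less_imp_neq[OF pos] by (simp add: diff_divide_eq_iff)
  ultimately show "pmf (G_pmf a B) B = a\<^sup>2 / (a\<^sup>2 + B\<^sup>2)"
    and "pmf (G_pmf a B) (- a\<^sup>2 / B) = B\<^sup>2 / (a\<^sup>2 + B\<^sup>2)"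
    using p by (simp_all add: G_pmf_def pmf_map measure_pmf_single)
qed

text \<open>The law of \<open>G\<^sub>1 + \<dots> + G\<^sub>m\<close> for independent \<open>G\<^sub>i\<close> with law \<^term>\<open>G_pmf (A i) B\<close>.\<close>

definition G_sum_pmf :: "nat \<Rightarrow> (nat \<Rightarrow> real) \<Rightarrow> real \<Rightarrow> real pmf" where
  "G_sum_pmf m A B =
     map_pmf (\<lambda>g. \<Sum>i=1..m. g i) (Pi_pmf {1..m} 0 (\<lambda>i. G_pmf (A i) B))"

definition P2_tilde :: "nat \<Rightarrow> (nat \<Rightarrow> real) \<Rightarrow> real \<Rightarrow> real \<Rightarrow> real" where
  "P2_tilde m A B u =
     (INF x\<in>{..<u}. measure_pmf.expectation (G_sum_pmf m A B) (\<lambda>s. (max (s - x) 0)\<^sup>2)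
                      / (max (u - x) 0)\<^sup>2)"

text \<open>Meaningful for \<open>0 \<le> \<delta> < 1\<close>, where the solution \<open>u\<close> exists and is unique.\<close>

definition q_threshold :: "real \<Rightarrow> nat \<Rightarrow> (nat \<Rightarrow> real) \<Rightarrow> real \<Rightarrow> real" where
  "q_threshold \<delta> m A B =
     (if \<delta> \<ge> measure_pmf.prob (G_sum_pmf m A B) {real m * B}
      then (THE u. P2_tilde m A B u = \<delta>)
      else real m * B + 1)"

end

theory Submission
  imports Defs
begin

text \<open>
  By a union bound over the blocks it suffices to bound, for each fixed \<open>m\<close>, the probability that
  one of \<open>S\<^sub>1, \<dots>, S\<^sub>m\<close> reaches the threshold. Doob's inequality for the submartingale
  \<open>(S\<^sub>n - x)\<^sub>+\<close> bounds it by \<open>E (S\<^sub>m - x)\<^sub>+\<^sup>2 / (u - x)\<^sup>2\<close> for all \<open>x < u\<close>. Replacing the summands one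
  at a time by the two-point variables \<open>G\<^sub>i\<close> only increases \<open>E (S\<^sub>m - x)\<^sub>+\<^sup>2\<close>: on \<open>(-\<infinity>, B]\<close> the
  function \<open>y \<mapsto> (y - t)\<^sub>+\<^sup>2\<close> lies below a parabola that agrees with it at both atoms of \<open>G\<^sub>i\<close>
  (Bentkus). The infimum over \<open>x\<close> equals the level \<open>\<delta>\<close> at the threshold once the defining
  equation is known to have exactly one solution; that solution is the minimum over \<open>x\<close> of
  \<open>F x / sqrt \<delta> + x\<close>, where \<open>F x = sqrt (E (G\<^sub>1 + \<dots> + G\<^sub>m - x)\<^sub>+\<^sup>2)\<close>.
\<close>

section \<open>The defining equation of the threshold\<close>

text \<open>As \<open>F\<close> is nonnegative, \<open>c^2\<close> with \<open>c >= 0\<close> bounds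
  the ratio from below exactly when the line \<open>c * (u - x)\<close> lies below the graph of
  \<open>F\<close>. A solution \<open>u\<close> is thus the zero of a line of slope
  \<open>- s\<close> that supports the graph from below.\<close>

lemma ratio_inf_unique_solution:
  fixes F :: "real \<Rightarrow> real"
  assumes cont: "continuous_on UNIV F"
    and nonneg: "\<And>x. 0 \<le> F x" and lower: "\<And>x. - x \<le> F x"
    and zero: "\<And>x. b \<le> x \<Longrightarrow> F x = 0" and pos: "\<And>x. x < b \<Longrightarrow> 0 < F x"
    and x1: "x1 < b" "F x1 \<le> s * (b - x1)"
    and s: "0 < s" "s < 1"
  shows "\<exists>!u. (INF x\<in>{..<u}. (F x)\<^sup>2 / (u - x)\<^sup>2) = s\<^sup>2"
proof -
  have bdd: "bdd_below ((\<lambda>x. (F x)\<^sup>2 / (u - x)\<^sup>2) ` {..<u})" for u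
    by (rule bdd_belowI[of _ 0]) auto
  define g where "g x = F x / s + x" for x
  have g_x1: "g x1 \<le> b"
    using x1 s by (simp add: g_def field_simps)
  obtain z where z: "z < b" "\<And>x. g z \<le> g x"
  proof -
    \<comment> \<open>Left of \<open>K\<close>, the bound \<open>- x <= F x\<close> gives
      \<open>g x >= - x * (1 - s) / s >= b\<close>; right of \<open>b\<close>,
      \<open>g x = x > b\<close>. Since \<open>g x1 <= b\<close> and \<open>x1\<close> lies in
      \<open>{K..b}\<close>, the minimum over this interval is global.\<close>
    define K where "K = min x1 (- (\<bar>b\<bar> * s / (1 - s)))"
    have "continuous_on {K..b} g"
      unfolding g_def using s by (auto intro!: continuous_intros continuous_on_subset[OF cont])
    moreover have "{K..b} \<noteq> {}"
      using x1 by (auto simp: K_def)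
    ultimately obtain y where y: "y \<in> {K..b}" "\<And>x. x \<in> {K..b} \<Longrightarrow> g y \<le> g x"
      using continuous_attains_inf[of "{K..b}" g] by auto
    have "x1 \<in> {K..b}"
      using x1 by (auto simp: K_def)
    then have "g y \<le> b"
      using y(2) g_x1 by fastforce
    have all: "g y \<le> g x" for x
    proof -
      consider "x < K" | "x \<in> {K..b}" | "b < x" by fastforce
      then show ?thesis
      proof cases
        case 1
        then have "\<bar>b\<bar> * s / (1 - s) \<le> - x"
          by (auto simp: K_def)
        then have "\<bar>b\<bar> * s \<le> - x * (1 - s)"
          using s by (simp add: pos_divide_le_eq)
        then have "b \<le> (- x * (1 - s)) / s"
          using s by (subst pos_le_divide_eq) (auto intro: order_trans[OF mult_right_mono[OF abs_ge_self]])
        also have "\<dots> = (- x) / s + x"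
          using s by (simp add: field_simps)
        also have "\<dots> \<le> g x"
          using divide_right_mono[OF lower[of x], of s] s by (simp add: g_def)
        finally show ?thesis using \<open>g y \<le> b\<close> by simp
      next
        case 3
        then show ?thesis using \<open>g y \<le> b\<close> zero[of x] by (simp add: g_def)
      qed (use y in auto)
    qed
    show thesis
    \<comment> \<open>The minimiser must lie strictly left of \<open>b\<close> so that
      \<open>F\<close> is positive there. If \<open>b\<close> is a minimiser, then so is
      \<open>x1\<close>, because \<open>g x1 <= b = g b\<close>.\<close>
    proof (cases "y = b")
      case True
      then have "g y = b" using zero[of b] by (simp add: g_def)
      then show thesis using that[of x1] x1 g_x1 all by (meson order_trans)
    next
      case False
      then show thesis using that[of y] y all by auto
    qed
  qed
  \<comment> \<open>The line \<open>s * (u0 - x)\<close> lies below \<open>F\<close> and touches it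
    at \<open>z\<close>.\<close>
  define u0 where "u0 = g z"
  have F_ge: "s * (u0 - x) \<le> F x" for x
    using z(2)[of x] s by (simp add: u0_def g_def field_simps)
  have F_z: "F z = s * (u0 - z)"
    using s by (simp add: u0_def g_def)
  have "z < u0"
    using pos[OF z(1)] F_z s by (simp add: zero_less_mult_iff)
  have ratio_ge: "c\<^sup>2 \<le> (INF x\<in>{..<u}. (F x)\<^sup>2 / (u - x)\<^sup>2)"
    if "\<And>x. c * (u - x) \<le> F x" "0 \<le> c" for c u
  proof (rule cINF_greatest)
    fix x assume "x \<in> {..<u}"
    then have "(c * (u - x))\<^sup>2 \<le> (F x)\<^sup>2"
      using that by (intro power_mono) auto
    then show "c\<^sup>2 \<le> (F x)\<^sup>2 / (u - x)\<^sup>2"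
      using \<open>x \<in> _\<close> by (simp add: pos_le_divide_eq power_mult_distrib)
  qed auto
  have ratio_z: "(INF x\<in>{..<u}. (F x)\<^sup>2 / (u - x)\<^sup>2) \<le> (s * (u0 - z) / (u - z))\<^sup>2"
    if "z < u" for u
    using cINF_lower[OF bdd, of z u] that by (simp add: F_z power_divide)
  show ?thesis
  proof (rule ex1I[of _ u0])
    show "(INF x\<in>{..<u0}. (F x)\<^sup>2 / (u0 - x)\<^sup>2) = s\<^sup>2"
      using ratio_ge[of s u0] ratio_z[of u0] F_ge s \<open>z < u0\<close> by (simp add: order_antisym)
  next
    fix u assume u: "(INF x\<in>{..<u}. (F x)\<^sup>2 / (u - x)\<^sup>2) = s\<^sup>2"
    show "u = u0"
    proof (cases u u0 rule: linorder_cases)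
      \<comment> \<open>Beyond \<open>u0\<close>, the ratio at \<open>z\<close> alone is already
        below \<open>s^2\<close>.\<close>
      case greater
      then have "s * (u0 - z) / (u - z) < s"
        using s \<open>z < u0\<close> by (simp add: pos_divide_less_eq)
      then have "(s * (u0 - z) / (u - z))\<^sup>2 < s\<^sup>2"
        using s \<open>z < u0\<close> greater by (intro power_strict_mono) auto
      then show ?thesis
        using ratio_z[of u] greater \<open>z < u0\<close> u by simp
    next
      case less
      \<comment> \<open>An average of the lower bounds \<open>s * (u0 - x)\<close> and \<open>- x\<close> of \<open>F x\<close> dominates \<open>s' * (u - x)\<close>
        with \<open>s' > s\<close>.\<close>
      define D where "D = s * (u0 - u) + \<bar>u\<bar> + 1"
      define t where "t = s * (u0 - u) / D"
      define s' where "s' = (1 - t) * s + t"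
      have D: "0 < D" using less s by (simp add: D_def add_nonneg_pos)
      have t: "0 < t" "t < 1"
        using less s D by (auto simp: t_def pos_divide_less_eq) (simp add: D_def)
      \<comment> \<open>\<open>D\<close> is chosen so that this difference, the slack of the
        averaged line over \<open>s' * (u - x)\<close>, is a nonnegative multiple of
        \<open>\<bar>u\<bar> + 1 - u\<close>.\<close>
      have "(1 - t) * s * u0 - s' * u = (1 - t) * (s * (u0 - u)) - t * u"
        by (simp add: s'_def algebra_simps)
      also have "\<dots> = (\<bar>u\<bar> + 1) / D * (s * (u0 - u)) - t * u"
      proof -
        have "1 - t = (\<bar>u\<bar> + 1) / D"
          using D by (simp add: t_def field_simps) (simp add: D_def algebra_simps)
        then show ?thesis by simp
      qed
      also have "(\<bar>u\<bar> + 1) / D * (s * (u0 - u)) - t * u = s * (u0 - u) * (\<bar>u\<bar> + 1 - u) / D"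
        using D by (simp add: t_def field_simps)
      also have "\<dots> \<ge> 0"
        using less s D by (intro divide_nonneg_pos mult_nonneg_nonneg) auto
      finally have key: "s' * u \<le> (1 - t) * s * u0" by simp
      have "s' * (u - x) \<le> F x" for x
      proof -
        have "s' * (u - x) \<le> (1 - t) * (s * (u0 - x)) + t * (- x)"
          using key by (simp add: s'_def algebra_simps)
        also have "\<dots> \<le> (1 - t) * F x + t * F x"
          using t F_ge lower by (intro add_mono mult_left_mono) auto
        finally show ?thesis by (simp add: algebra_simps)
      qed
      moreover have "s < s'"
        using t s mult_strict_left_mono[of s 1 t] by (simp add: s'_def algebra_simps)
      ultimately have "s'\<^sup>2 \<le> s\<^sup>2"
        using ratio_ge[of s' u] u s by auto
      moreover have "s\<^sup>2 < s'\<^sup>2"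
        using \<open>s < s'\<close> s by (intro power_strict_mono) auto
      ultimately show ?thesis by simp
    qed
  qed
qed

section \<open>The law of the sum of the two-point variables and its truncated second moment\<close>

lemma G_sum_pmf_0: "G_sum_pmf 0 A B = return_pmf 0"
  by (simp add: G_sum_pmf_def)

lemma G_sum_pmf_Suc:
  "G_sum_pmf (Suc n) A B =
     G_pmf (A (Suc n)) B \<bind> (\<lambda>y. map_pmf (\<lambda>s. s + y) (G_sum_pmf n A B))"
proof -
  have "{1..Suc n} = insert (Suc n) {1..n}"
    by auto
  moreover have "sum (f(Suc n := y)) (insert (Suc n) {1..n}) = sum f {1..n} + y"
    for f :: "nat \<Rightarrow> real" and y
    by (subst sum.insert) (auto simp: add.commute intro!: sum.cong)
  ultimately show ?thesis
    unfolding G_sum_pmf_def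
    by (simp add: Pi_pmf_insert' map_bind_pmf pmf.map_comp o_def map_pmf_def[symmetric]
        del: fun_upd_apply)
qed

lemma G_pmf_prob:
  fixes a B :: real
  assumes "a > 0" "B > 0"
  shows "0 < a\<^sup>2 / (a\<^sup>2 + B\<^sup>2)" "a\<^sup>2 / (a\<^sup>2 + B\<^sup>2) < 1"
  using assms by (simp_all add: add_pos_pos)

lemma set_G_pmf:
  assumes "a > 0" "B > 0"
  shows "set_pmf (G_pmf a B) = {B, - a\<^sup>2 / B}"
  using G_pmf_prob[OF assms] by (auto simp: G_pmf_def set_pmf_bernoulli UNIV_bool)

text \<open>The numerator of the ratio in \<open>P2_tilde\<close>; its square root is the
  \<open>F\<close> to which \<open>ratio_inf_unique_solution\<close> is applied.\<close>

definition G_tail :: "nat \<Rightarrow> (nat \<Rightarrow> real) \<Rightarrow> real \<Rightarrow> real \<Rightarrow> real" where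
  "G_tail n A B x = measure_pmf.expectation (G_sum_pmf n A B) (\<lambda>s. (max (s - x) 0)\<^sup>2)"

locale G_summands =
  fixes A :: "nat \<Rightarrow> real" and B :: real
  assumes B_pos: "B > 0" and A_pos: "\<And>i. i \<ge> 1 \<Longrightarrow> A i > 0"
begin

lemma finite_set_G_sum_pmf: "finite (set_pmf (G_sum_pmf n A B))"
  by (induction n) (auto simp: G_sum_pmf_0 G_sum_pmf_Suc set_G_pmf A_pos B_pos)

lemma set_G_sum_pmf_le: "s \<in> set_pmf (G_sum_pmf n A B) \<Longrightarrow> s \<le> real n * B"
proof (induction n arbitrary: s)
  case (Suc n)
  have "- (A (Suc n))\<^sup>2 / B \<le> 0"
    using B_pos by (simp add: divide_nonpos_pos)
  then have "- (A (Suc n))\<^sup>2 / B \<le> B"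
    using B_pos by linarith
  moreover obtain r y where "r \<in> set_pmf (G_sum_pmf n A B)" "s = r + y" "y \<in> {B, - (A (Suc n))\<^sup>2 / B}"
    using Suc.prems by (auto simp: G_sum_pmf_Suc set_G_pmf A_pos B_pos)
  ultimately show ?case
    using Suc.IH[of r] by (auto simp: algebra_simps)
qed (simp add: G_sum_pmf_0)

lemma max_in_set_G_sum_pmf: "real n * B \<in> set_pmf (G_sum_pmf n A B)"
proof (induction n)
  case (Suc n)
  then have "real n * B + B \<in> set_pmf (G_sum_pmf (Suc n) A B)"
    by (auto simp: G_sum_pmf_Suc set_G_pmf A_pos B_pos)
  then show ?case by (simp add: algebra_simps)
qed (simp add: G_sum_pmf_0)

lemma integrable_G_sum_pmf: "integrable (G_sum_pmf n A B) (f :: real \<Rightarrow> real)"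
  by (rule integrable_measure_pmf_finite[OF finite_set_G_sum_pmf])

lemma expectation_G_sum_pmf_Suc:
  fixes f :: "real \<Rightarrow> real"
  defines "p n \<equiv> (A (Suc n))\<^sup>2 / ((A (Suc n))\<^sup>2 + B\<^sup>2)"
  shows "measure_pmf.expectation (G_sum_pmf (Suc n) A B) f =
    p n * measure_pmf.expectation (G_sum_pmf n A B) (\<lambda>s. f (s + B)) +
    (1 - p n) * measure_pmf.expectation (G_sum_pmf n A B) (\<lambda>s. f (s - (A (Suc n))\<^sup>2 / B))"
proof -
  have p: "0 < p n" "p n < 1"
    using G_pmf_prob[of "A (Suc n)" B] A_pos B_pos by (auto simp: p_def)
  have "G_sum_pmf (Suc n) A B = bernoulli_pmf (p n) \<bind>
      (\<lambda>b. map_pmf (\<lambda>s. s + (if b then B else - (A (Suc n))\<^sup>2 / B)) (G_sum_pmf n A B))"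
    by (simp add: G_sum_pmf_Suc G_pmf_def bind_map_pmf p_def)
  then show ?thesis
    using p finite_set_G_sum_pmf by (simp add: pmf_expectation_bind[of UNIV] UNIV_bool)
qed

lemma expectation_G_sum_pmf: "measure_pmf.expectation (G_sum_pmf n A B) (\<lambda>s. s) = 0"
proof (induction n)
  case (Suc n)
  let ?a = "A (Suc n)"
  have "?a\<^sup>2 / (?a\<^sup>2 + B\<^sup>2) * B = (1 - ?a\<^sup>2 / (?a\<^sup>2 + B\<^sup>2)) * (?a\<^sup>2 / B)"
    using B_pos A_pos[of "Suc n"] add_pos_pos[of "?a\<^sup>2" "B\<^sup>2"]
    by (simp add: divide_simps) (simp add: power2_eq_square algebra_simps)
  with Suc show ?case
    by (simp add: expectation_G_sum_pmf_Suc integrable_G_sum_pmf)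
qed (simp add: G_sum_pmf_0)

lemma G_tail_nonneg: "0 \<le> G_tail n A B x"
  by (simp add: G_tail_def)

lemma G_tail_sum: "G_tail n A B x = (\<Sum>s\<in>set_pmf (G_sum_pmf n A B). pmf (G_sum_pmf n A B) s * (max (s - x) 0)\<^sup>2)"
  by (simp add: G_tail_def integral_measure_pmf[OF finite_set_G_sum_pmf])

lemma continuous_G_tail: "continuous_on UNIV (G_tail n A B)"
  unfolding G_tail_sum[abs_def] by (intro continuous_intros)

lemma G_tail_eq_0: "real n * B \<le> x \<Longrightarrow> G_tail n A B x = 0"
  unfolding G_tail_sum by (intro sum.neutral) (auto dest: set_G_sum_pmf_le)

lemma G_tail_ge_sq:
  assumes "x \<le> 0"
  shows "x\<^sup>2 \<le> G_tail n A B x"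
proof -
  \<comment> \<open>Jensen's inequality, via the tangent line of the squared positive part at \<open>- x\<close>.\<close>
  have "measure_pmf.expectation (G_sum_pmf n A B) (\<lambda>s. 2 * (- x) * (s - x) - x\<^sup>2) \<le> G_tail n A B x"
    unfolding G_tail_def
  proof (intro integral_mono integrable_G_sum_pmf)
    fix s :: real
    show "2 * (- x) * (s - x) - x\<^sup>2 \<le> (max (s - x) 0)\<^sup>2"
    proof (cases "s \<le> x")
      case True
      then have "x * (s - x) \<ge> 0" using assms by (simp add: mult_nonpos_nonpos)
      then have "2 * (- x) * (s - x) - x\<^sup>2 \<le> 0"
        using zero_le_power2[of x] by linarith
      with True show ?thesis by (simp add: max_def)
    next
      case False
      have "0 \<le> s\<^sup>2" by simp
      with False show ?thesis by (simp add: max_def power2_eq_square algebra_simps)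
    qed
  qed
  moreover have "measure_pmf.expectation (G_sum_pmf n A B) (\<lambda>s. 2 * (- x) * (s - x) - x\<^sup>2) = x\<^sup>2"
    by (simp add: integrable_G_sum_pmf expectation_G_sum_pmf power2_eq_square)
  ultimately show ?thesis by simp
qed

lemma G_tail_ge_max:
  "pmf (G_sum_pmf n A B) (real n * B) * (max (real n * B - x) 0)\<^sup>2 \<le> G_tail n A B x"
  unfolding G_tail_sum
  by (rule member_le_sum[OF max_in_set_G_sum_pmf _ finite_set_G_sum_pmf]) simp

text \<open>From the second largest atom onwards only the top atom contributes. This provides the
  point \<open>x1\<close> required by \<open>ratio_inf_unique_solution\<close>.\<close>

lemma G_tail_eq_near_max:
  "\<exists>x<real n * B. G_tail n A B x = pmf (G_sum_pmf n A B) (real n * B) * (real n * B - x)\<^sup>2"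
proof -
  let ?b = "real n * B" and ?N = "set_pmf (G_sum_pmf n A B)"
  \<comment> \<open>The extra element \<open>?b - 1\<close> keeps the set nonempty when
    \<open>?b\<close> is the only atom, as for \<open>n = 0\<close>.\<close>
  define x where "x = Max (insert (?b - 1) (?N - {?b}))"
  have "s < ?b" if "s \<in> insert (?b - 1) (?N - {?b})" for s
    using that set_G_sum_pmf_le[of s n] by auto
  then have x: "x < ?b" "\<And>s. s \<in> ?N \<Longrightarrow> s \<noteq> ?b \<Longrightarrow> s \<le> x"
    unfolding x_def using finite_set_G_sum_pmf[of n] by (auto intro!: Max_ge)
  have "G_tail n A B x = (\<Sum>s\<in>{?b}. pmf (G_sum_pmf n A B) s * (max (s - x) 0)\<^sup>2)"
    unfolding G_tail_sum using x max_in_set_G_sum_pmf[of n] finite_set_G_sum_pmf[of n]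
    by (intro sum.mono_neutral_right) auto
  with x(1) show ?thesis by (intro exI[of _ x]) simp
qed

text \<open>Unique solvability with slope \<open>sqrt \<delta>\<close> gives the \<open>THE\<close>
  in \<open>q_threshold\<close> its meaning. The assumption on the mass of the top atom yields
  \<open>F x1 <= sqrt \<delta> * (real m * B - x1)\<close>.\<close>

lemma P2_tilde_q_threshold:
  assumes ge: "measure_pmf.prob (G_sum_pmf m A B) {real m * B} \<le> \<delta>" and "\<delta> < 1"
  shows "P2_tilde m A B (q_threshold \<delta> m A B) = \<delta>"
proof -
  define p where "p = pmf (G_sum_pmf m A B) (real m * B)"
  define F where "F x = sqrt (G_tail m A B x)" for x
  have p: "0 < p" "p \<le> \<delta>"
    using max_in_set_G_sum_pmf[of m] ge
    by (auto simp: p_def pmf_positive_iff measure_pmf_single)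
  have F_sq: "(F x)\<^sup>2 = G_tail m A B x" for x
    using G_tail_nonneg by (simp add: F_def)
  obtain x1 where x1: "x1 < real m * B" "G_tail m A B x1 = p * (real m * B - x1)\<^sup>2"
    using G_tail_eq_near_max[of m] by (auto simp: p_def)
  have "\<exists>!u. (INF x\<in>{..<u}. (F x)\<^sup>2 / (u - x)\<^sup>2) = (sqrt \<delta>)\<^sup>2"
  proof (rule ratio_inf_unique_solution)
    show "continuous_on UNIV F"
      unfolding F_def[abs_def] by (intro continuous_intros continuous_G_tail)
    show F_nonneg: "0 \<le> F x" for x
      using G_tail_nonneg by (simp add: F_def)
    show "- x \<le> F x" for x
    proof (cases "x \<le> 0")
      case True
      then show ?thesis
        using G_tail_ge_sq[of x m] by (simp add: F_def real_le_rsqrt)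
    next
      case False
      then show ?thesis using F_nonneg[of x] by simp
    qed
    show "F x = 0" if "real m * B \<le> x" for x
      using G_tail_eq_0[OF that] by (simp add: F_def)
    show "0 < F x" if "x < real m * B" for x
    proof -
      have "0 < p * (max (real m * B - x) 0)\<^sup>2"
        using p that by simp
      also have "\<dots> \<le> G_tail m A B x"
        unfolding p_def by (rule G_tail_ge_max)
      finally show ?thesis by (simp add: F_def)
    qed
    show "x1 < real m * B" by fact
    show "F x1 \<le> sqrt \<delta> * (real m * B - x1)"
      using x1 p by (simp add: F_def real_sqrt_mult)
    show "0 < sqrt \<delta>" "sqrt \<delta> < 1"
      using p assms(2) by auto
  qed
  moreover have "P2_tilde m A B u = (INF x\<in>{..<u}. (F x)\<^sup>2 / (u - x)\<^sup>2)" for u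
    unfolding P2_tilde_def F_sq G_tail_def by (intro INF_cong) auto
  ultimately have "\<exists>!u. P2_tilde m A B u = \<delta>"
    using p by simp
  then show ?thesis
    using ge theI'[of "\<lambda>u. P2_tilde m A B u = \<delta>"] by (simp add: q_threshold_def)
qed

end

section \<open>The one-step comparison\<close>

text \<open>
  The parabola \<open>majorant_curv a B t * (y + majorant_shift a B t)\<^sup>2\<close> in \<open>y\<close> agrees with \<open>(y - t)\<^sub>+\<^sup>2\<close> at
  the atoms \<open>B\<close> and \<open>- a\<^sup>2 / B\<close>; when \<open>- a\<^sup>2 / B < t\<close>, its vertex is the lower atom.
\<close>

definition majorant_curv :: "real \<Rightarrow> real \<Rightarrow> real \<Rightarrow> real" where
  "majorant_curv a B t = (if t \<le> - a\<^sup>2 / B then 1 else (max (B - t) 0)\<^sup>2 / (B + a\<^sup>2 / B)\<^sup>2)"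

definition majorant_shift :: "real \<Rightarrow> real \<Rightarrow> real \<Rightarrow> real" where
  "majorant_shift a B t = (if t \<le> - a\<^sup>2 / B then - t else a\<^sup>2 / B)"

context
  fixes a B :: real
  assumes a: "a > 0" and B: "B > 0"
begin

text \<open>For \<open>t\<close> above the lower atom \<open>- d\<close> and
  \<open>t < y <= B\<close>, take square roots: the line \<open>y - t\<close> stays below the line
  through \<open>(- d, 0)\<close> and \<open>(B, B - t)\<close>, the gap being
  \<open>(B - y) * (t + d) / (B + d)\<close>.\<close>

lemma majorant:
  assumes "y \<le> B"
  shows "(max (y - t) 0)\<^sup>2 \<le> majorant_curv a B t * (y + majorant_shift a B t)\<^sup>2"
proof (cases "t \<le> - a\<^sup>2 / B")
  case True
  then show ?thesis
    by (auto simp: majorant_curv_def majorant_shift_def max_def)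
next
  case False
  define d where "d = a\<^sup>2 / B"
  have d: "0 < d" "- d < t"
    using False a B by (auto simp: d_def)
  show ?thesis
  proof (cases "y \<le> t")
    case True
    then show ?thesis using False
      by (simp add: majorant_curv_def majorant_shift_def max_def)
  next
    case y: False
    have "(y - t) * (B + d) \<le> (B - t) * (y + d)"
    proof -
      have "(B - t) * (y + d) - (y - t) * (B + d) = (B - y) * (t + d)"
        by (simp add: algebra_simps)
      also have "\<dots> \<ge> 0" using assms d by simp
      finally show ?thesis by simp
    qed
    then have "y - t \<le> (B - t) * (y + d) / (B + d)"
      using B d by (simp add: pos_le_divide_eq)
    then have "(y - t)\<^sup>2 \<le> ((B - t) * (y + d) / (B + d))\<^sup>2"
      using y by (intro power_mono) auto
    then show ?thesis using False y assms
      by (simp add: majorant_curv_def majorant_shift_def max_def d_def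
          power_mult_distrib power_divide)
  qed
qed

text \<open>The left side is the mean of the parabola under any centred law of variance
  \<open>a^2\<close>. The two-point law is one of these, and on its atoms the parabola equals the
  squared positive part.\<close>

lemma majorant_expectation:
  "majorant_curv a B t * (a\<^sup>2 + (majorant_shift a B t)\<^sup>2) =
     a\<^sup>2 / (a\<^sup>2 + B\<^sup>2) * (max (B - t) 0)\<^sup>2 +
     (1 - a\<^sup>2 / (a\<^sup>2 + B\<^sup>2)) * (max (- a\<^sup>2 / B - t) 0)\<^sup>2"
proof -
  define d where "d = a\<^sup>2 / B"
  have d: "0 < d" "a\<^sup>2 = d * B"
    using a B by (auto simp: d_def)
  have p: "a\<^sup>2 / (a\<^sup>2 + B\<^sup>2) = d / (d + B)"
  proof -
    have "a\<^sup>2 + B\<^sup>2 = (d + B) * B"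
      using d by (simp add: power2_eq_square algebra_simps)
    then show ?thesis using B d(2) by simp
  qed
  have q: "1 - d / (d + B) = B / (d + B)"
    using B d by (simp add: field_simps)
  have md: "- a\<^sup>2 / B = - d" by (simp add: d_def)
  show ?thesis
  proof (cases "t \<le> - d")
    case True
    have "(d * B + t\<^sup>2) * (d + B) = d * (B - t)\<^sup>2 + B * (- d - t)\<^sup>2"
      by (simp add: power2_eq_square algebra_simps)
    then have "d * B + t\<^sup>2 = (d * (B - t)\<^sup>2 + B * (- d - t)\<^sup>2) / (d + B)"
      using B d by (simp add: eq_divide_eq)
    with True B d show ?thesis
      unfolding majorant_curv_def majorant_shift_def p q md
      by (simp add: max_def add_divide_distrib)
  next
    case False
    have "(d * B + d\<^sup>2) / (B + d)\<^sup>2 = d / (d + B)"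
    proof -
      have "d * B + d\<^sup>2 = d * (B + d)"
        by (simp add: power2_eq_square algebra_simps)
      then show ?thesis using B d(1) by (simp add: power2_eq_square add.commute)
    qed
    then have "(max (B - t) 0)\<^sup>2 / (B + d)\<^sup>2 * (d * B + d\<^sup>2) = d / (d + B) * (max (B - t) 0)\<^sup>2"
      by (metis mult.commute times_divide_eq_right)
    with False show ?thesis
      unfolding majorant_curv_def majorant_shift_def p q md d_def[symmetric]
      by (simp add: d(2))
  qed
qed

text \<open>Together with \<open>majorant_shift_bound\<close>, this gives integrability of the
  parabola when \<open>t\<close> is the random level \<open>x - S\<close>.\<close>

lemma majorant_curv_bounds: "0 \<le> majorant_curv a B t" "majorant_curv a B t \<le> 1"
proof -
  show "0 \<le> majorant_curv a B t"
    by (simp add: majorant_curv_def)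
  have "0 < a\<^sup>2 / B" using a B by simp
  then show "majorant_curv a B t \<le> 1"
    using B by (auto simp: majorant_curv_def power_divide[symmetric] intro!: power_le_one)
qed

lemma majorant_shift_bound: "\<bar>majorant_shift a B t\<bar> \<le> \<bar>t\<bar> + a\<^sup>2 / B"
  using B by (auto simp: majorant_shift_def)

end

lemma borel_measurable_majorant [measurable]:
  "majorant_curv a B \<in> borel_measurable borel" "majorant_shift a B \<in> borel_measurable borel"
  unfolding majorant_curv_def[abs_def] majorant_shift_def[abs_def] by measurable

text \<open>The parabola is taken at the random level \<open>t = x - S\<close>. Independence of
  \<open>S\<close> and \<open>Y\<close> leaves only the first two moments of \<open>Y\<close>, which
  \<open>majorant_expectation\<close> trades for the two atoms.\<close>

lemma (in prob_space) expectation_pos_part_sq_add_le: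
  fixes S Y :: "'a \<Rightarrow> real"
  assumes ind: "indep_var borel S borel Y"
    and S: "integrable M S" "integrable M (\<lambda>\<omega>. (S \<omega>)\<^sup>2)"
    and Y: "integrable M Y" "integrable M (\<lambda>\<omega>. (Y \<omega>)\<^sup>2)"
      "expectation Y = 0" "variance Y \<le> a\<^sup>2" "AE \<omega> in M. Y \<omega> \<le> B"
    and a: "a > 0" and B: "B > 0"
  defines "p \<equiv> a\<^sup>2 / (a\<^sup>2 + B\<^sup>2)"
  shows "expectation (\<lambda>\<omega>. (max (S \<omega> + Y \<omega> - x) 0)\<^sup>2) \<le>
    p * expectation (\<lambda>\<omega>. (max (S \<omega> - (x - B)) 0)\<^sup>2) +
    (1 - p) * expectation (\<lambda>\<omega>. (max (S \<omega> - (x + a\<^sup>2 / B)) 0)\<^sup>2)"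
proof -
  have [measurable]: "S \<in> borel_measurable M" "Y \<in> borel_measurable M"
    using S Y by auto
  define \<kappa> where "\<kappa> \<omega> = majorant_curv a B (x - S \<omega>)" for \<omega>
  define e where "e \<omega> = majorant_shift a B (x - S \<omega>)" for \<omega>
  have [measurable]: "\<kappa> \<in> borel_measurable M" "e \<in> borel_measurable M"
    unfolding \<kappa>_def[abs_def] e_def[abs_def] by measurable
  have \<kappa>: "0 \<le> \<kappa> \<omega>" "\<kappa> \<omega> \<le> 1" for \<omega>
    using majorant_curv_bounds[OF a B] by (auto simp: \<kappa>_def)
  define b where "b \<omega> = \<bar>x - S \<omega>\<bar> + a\<^sup>2 / B" for \<omega>
  have e: "\<bar>e \<omega>\<bar> \<le> b \<omega>" for \<omega>
    using majorant_shift_bound[OF a B] by (auto simp: e_def b_def)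
  have sq_int: "integrable M (\<lambda>\<omega>. (S \<omega> + c)\<^sup>2)" for c
    using S by (simp add: power2_sum)
  have sq_int': "integrable M (\<lambda>\<omega>. (x - S \<omega>)\<^sup>2)"
    using sq_int[of "- x"] by (simp add: power2_commute)
  have b_sq: "integrable M (\<lambda>\<omega>. (b \<omega>)\<^sup>2)"
    unfolding b_def power2_sum using S sq_int' by auto
  have b_int: "integrable M b"
    unfolding b_def[abs_def] using S by auto
  have int_\<kappa>: "integrable M \<kappa>"
    using \<kappa> by (intro integrable_const_bound[of _ 1]) auto
  have "\<bar>\<kappa> \<omega> * e \<omega>\<bar> \<le> 1 * b \<omega>" for \<omega>
    unfolding abs_mult using \<kappa>[of \<omega>] e[of \<omega>] by (intro mult_mono) auto
  then have int_\<kappa>e: "integrable M (\<lambda>\<omega>. \<kappa> \<omega> * e \<omega>)"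
    by (intro Bochner_Integration.integrable_bound[OF b_int] AE_I2)
      (auto intro: order_trans[OF _ abs_ge_self])
  have "(e \<omega>)\<^sup>2 \<le> (b \<omega>)\<^sup>2" for \<omega>
    using power_mono[OF e[of \<omega>], of 2] by simp
  then have "\<kappa> \<omega> * (e \<omega>)\<^sup>2 \<le> 1 * (b \<omega>)\<^sup>2" for \<omega>
    using \<kappa>[of \<omega>] by (intro mult_mono) auto
  then have int_\<kappa>ee: "integrable M (\<lambda>\<omega>. \<kappa> \<omega> * (e \<omega>)\<^sup>2)"
    using \<kappa> by (intro Bochner_Integration.integrable_bound[OF b_sq] AE_I2) (auto simp: abs_mult)
  have ind_\<kappa>: "indep_var borel \<kappa> borel (\<lambda>\<omega>. (Y \<omega>)\<^sup>2)"
    using indep_var_compose[OF ind, of "\<lambda>s. majorant_curv a B (x - s)" borel "\<lambda>y. y\<^sup>2" borel]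
    by (simp add: o_def \<kappa>_def[abs_def])
  have "indep_var borel ((\<lambda>s. majorant_curv a B (x - s) * majorant_shift a B (x - s)) \<circ> S)
      borel ((\<lambda>y. y) \<circ> Y)"
    by (rule indep_var_compose[OF ind]) measurable
  then have ind_\<kappa>e: "indep_var borel (\<lambda>\<omega>. \<kappa> \<omega> * e \<omega>) borel Y"
    unfolding o_def \<kappa>_def e_def .
  note prod_int = indep_var_integrable[OF ind_\<kappa> int_\<kappa> Y(2)] indep_var_integrable[OF ind_\<kappa>e int_\<kappa>e Y(1)]
  have pos_int: "integrable M (\<lambda>\<omega>. (max (S \<omega> - c) 0)\<^sup>2)" for c
    by (rule Bochner_Integration.integrable_bound[OF sq_int[of "- c"]]) (auto simp: max_def)
  \<comment> \<open>Each mixed term is a function of \<open>S\<close> times a power of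
    \<open>Y\<close>, so its expectation factorises; the linear one vanishes since \<open>Y\<close>
    is centred.\<close>
  have quad: "\<kappa> \<omega> * (Y \<omega> + e \<omega>)\<^sup>2 = \<kappa> \<omega> * (Y \<omega>)\<^sup>2 + 2 * (\<kappa> \<omega> * e \<omega> * Y \<omega>) + \<kappa> \<omega> * (e \<omega>)\<^sup>2" for \<omega>
    by (simp add: power2_eq_square algebra_simps)
  have quad_int: "integrable M (\<lambda>\<omega>. \<kappa> \<omega> * (Y \<omega> + e \<omega>)\<^sup>2)"
    unfolding quad using prod_int int_\<kappa>ee by auto
  have "expectation (\<lambda>\<omega>. (max (S \<omega> + Y \<omega> - x) 0)\<^sup>2) \<le> expectation (\<lambda>\<omega>. \<kappa> \<omega> * (Y \<omega> + e \<omega>)\<^sup>2)"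
  proof (rule integral_mono_AE')
    show "AE \<omega> in M. (max (S \<omega> + Y \<omega> - x) 0)\<^sup>2 \<le> \<kappa> \<omega> * (Y \<omega> + e \<omega>)\<^sup>2"
      using Y(5)
    proof eventually_elim
      case (elim \<omega>)
      then show ?case
        using majorant[OF a B, of "Y \<omega>" "x - S \<omega>"] by (simp add: \<kappa>_def e_def algebra_simps)
    qed
  qed (use quad_int \<kappa> in auto)
  also have "\<dots> = expectation \<kappa> * expectation (\<lambda>\<omega>. (Y \<omega>)\<^sup>2) + expectation (\<lambda>\<omega>. \<kappa> \<omega> * (e \<omega>)\<^sup>2)"
    unfolding quad using prod_int int_\<kappa>ee Y(3)
    by (simp add: indep_var_lebesgue_integral[OF ind_\<kappa> int_\<kappa> Y(2)]
        indep_var_lebesgue_integral[OF ind_\<kappa>e int_\<kappa>e Y(1)])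
  \<comment> \<open>Because the curvature is nonnegative, an upper bound on the variance
    suffices.\<close>
  also have "\<dots> \<le> expectation \<kappa> * a\<^sup>2 + expectation (\<lambda>\<omega>. \<kappa> \<omega> * (e \<omega>)\<^sup>2)"
    using Y(3,4) \<kappa> by (intro add_right_mono mult_left_mono) auto
  also have "\<dots> = expectation (\<lambda>\<omega>. \<kappa> \<omega> * (a\<^sup>2 + (e \<omega>)\<^sup>2))"
    using int_\<kappa> int_\<kappa>ee by (simp add: distrib_left)
  also have "\<dots> = expectation (\<lambda>\<omega>. p * (max (S \<omega> - (x - B)) 0)\<^sup>2 + (1 - p) * (max (S \<omega> - (x + a\<^sup>2 / B)) 0)\<^sup>2)"
    unfolding \<kappa>_def e_def majorant_expectation[OF a B] p_def by (simp add: algebra_simps)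
  also have "\<dots> = p * expectation (\<lambda>\<omega>. (max (S \<omega> - (x - B)) 0)\<^sup>2) +
    (1 - p) * expectation (\<lambda>\<omega>. (max (S \<omega> - (x + a\<^sup>2 / B)) 0)\<^sup>2)"
    using pos_int by simp
  finally show ?thesis .
qed

section \<open>The maximal inequality\<close>

locale bounded_summands = prob_space M + G_summands A B
  for M :: "'a measure" and A :: "nat \<Rightarrow> real" and B :: real +
  fixes X :: "nat \<Rightarrow> 'a \<Rightarrow> real"
  assumes indep: "indep_vars (\<lambda>_. borel) X {1..}"
    and integrable_X: "\<And>i. i \<ge> 1 \<Longrightarrow> integrable M (X i)"
    and integrable_X_sq: "\<And>i. i \<ge> 1 \<Longrightarrow> integrable M (\<lambda>\<omega>. (X i \<omega>)\<^sup>2)"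
    and expectation_X: "\<And>i. i \<ge> 1 \<Longrightarrow> expectation (X i) = 0"
    and variance_X: "\<And>i. i \<ge> 1 \<Longrightarrow> variance (X i) \<le> (A i)\<^sup>2"
    and AE_X_le: "\<And>i. i \<ge> 1 \<Longrightarrow> AE \<omega> in M. X i \<omega> \<le> B"
begin

definition S :: "nat \<Rightarrow> 'a \<Rightarrow> real" where
  "S n \<omega> = (\<Sum>i=1..n. X i \<omega>)"

lemma S_Suc: "S (Suc n) \<omega> = S n \<omega> + X (Suc n) \<omega>"
  by (simp add: S_def)

lemma integrable_S: "integrable M (S n)"
  unfolding S_def[abs_def] using integrable_X by (intro Bochner_Integration.integrable_sum) auto

lemma measurable_S [measurable]: "S n \<in> borel_measurable M"
  using integrable_S by auto

text \<open>Index \<open>0\<close> is excluded, so \<open>exceed u 0\<close> is empty; this starts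
  the induction for Doob's inequality.\<close>

definition exceed :: "real \<Rightarrow> nat \<Rightarrow> 'a set" where
  "exceed u n = {\<omega> \<in> space M. \<exists>j\<in>{1..n}. u \<le> S j \<omega>}"

lemma exceed_sets [measurable]: "exceed u n \<in> events"
  unfolding exceed_def by measurable

text \<open>Restrictions of an independent family to the disjoint index sets \<open>{1..n}\<close>
  and \<open>{Suc n}\<close> are independent. A general \<open>f\<close> is allowed because the
  first passage event depends on the whole path.\<close>

lemma indep_var_past_next:
  assumes f: "f \<in> borel_measurable (PiM {1..n} (\<lambda>_. borel))"
  shows "indep_var borel (\<lambda>\<omega>. f (\<lambda>i\<in>{1..n}. X i \<omega>)) borel (X (Suc n))"
proof -
  have "indep_var borel (f \<circ> (\<lambda>\<omega>. \<lambda>i\<in>{1..n}. X i \<omega>))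
      borel ((\<lambda>w. w (Suc n)) \<circ> (\<lambda>\<omega>. \<lambda>i\<in>{Suc n}. X i \<omega>))"
    using f by (intro indep_var_compose[OF indep_var_restrict[OF indep]]) auto
  then show ?thesis by (simp add: o_def)
qed

lemma indep_var_S_next: "indep_var borel (S n) borel (X (Suc n))"
  using indep_var_past_next[of "\<lambda>w. \<Sum>i=1..n. w i" n] by (simp add: S_def[abs_def])

lemma integrable_S_sq: "integrable M (\<lambda>\<omega>. (S n \<omega>)\<^sup>2)"
proof (induction n)
  case (Suc n)
  have "integrable M (\<lambda>\<omega>. S n \<omega> * X (Suc n) \<omega>)"
    by (rule indep_var_integrable[OF indep_var_S_next integrable_S integrable_X]) simp
  with Suc show ?case
    using integrable_X_sq[of "Suc n"] by (simp add: S_Suc power2_sum mult.assoc)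
qed (simp add: S_def)

lemma integrable_pos_part_S: "integrable M (\<lambda>\<omega>. max (S n \<omega> - x) 0)"
  using integrable_S by auto

lemma integrable_pos_part_S_sq: "integrable M (\<lambda>\<omega>. (max (S n \<omega> - x) 0)\<^sup>2)"
proof (rule Bochner_Integration.integrable_bound)
  show "integrable M (\<lambda>\<omega>. (S n \<omega> + (- x))\<^sup>2)"
    unfolding power2_sum using integrable_S_sq[of n] integrable_S[of n] by auto
qed (auto simp: max_def)

text \<open>The one-step comparison replaces the last summand and shifts the level to
  \<open>x - B\<close> or \<open>x + a^2 / B\<close> with \<open>a = A (Suc n)\<close>, hence the
  induction over all \<open>x\<close>.\<close>

lemma expectation_pos_part_S_le:
  "expectation (\<lambda>\<omega>. (max (S n \<omega> - x) 0)\<^sup>2) \<le> G_tail n A B x"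
proof (induction n arbitrary: x)
  case 0
  then show ?case by (simp add: S_def G_tail_def G_sum_pmf_0 prob_space)
next
  case (Suc n)
  let ?p = "(A (Suc n))\<^sup>2 / ((A (Suc n))\<^sup>2 + B\<^sup>2)"
  have p: "0 < ?p" "?p < 1"
    using G_pmf_prob[of "A (Suc n)" B] A_pos B_pos by auto
  have "expectation (\<lambda>\<omega>. (max (S (Suc n) \<omega> - x) 0)\<^sup>2) \<le>
      ?p * expectation (\<lambda>\<omega>. (max (S n \<omega> - (x - B)) 0)\<^sup>2) +
      (1 - ?p) * expectation (\<lambda>\<omega>. (max (S n \<omega> - (x + (A (Suc n))\<^sup>2 / B)) 0)\<^sup>2)"
    unfolding S_Suc
    by (intro expectation_pos_part_sq_add_le indep_var_S_next integrable_S integrable_S_sq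
        integrable_X integrable_X_sq expectation_X variance_X AE_X_le A_pos B_pos) auto
  also have "\<dots> \<le> ?p * G_tail n A B (x - B) + (1 - ?p) * G_tail n A B (x + (A (Suc n))\<^sup>2 / B)"
    using p by (intro add_mono mult_left_mono Suc) auto
  also have "\<dots> = G_tail (Suc n) A B x"
    unfolding G_tail_def expectation_G_sum_pmf_Suc by (simp add: algebra_simps)
  finally show ?case .
qed

text \<open>
  Doob's inequality for \<open>max (S n - x) 0\<close>, by the first passage decomposition: after the first
  passage the square grows in expectation, since its tangent at \<open>S n\<close> is linear in the centred
  increment.
\<close>

lemma exceed_prob_le:
  assumes "x < u"
  shows "(u - x)\<^sup>2 * prob (exceed u n) \<le>
    expectation (\<lambda>\<omega>. indicator (exceed u n) \<omega> * (max (S n \<omega> - x) 0)\<^sup>2)"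
proof (induction n)
  case 0
  then show ?case by (simp add: exceed_def)
next
  case (Suc n)
  let ?I = "\<lambda>n. indicator (exceed u n) :: 'a \<Rightarrow> real"
  \<comment> \<open>The first passage indicator times the positive part, written in the coordinates
    of the path so that \<open>indep_var_past_next\<close> applies.\<close>
  define f where "f w = (if \<exists>j\<in>{1..n}. u \<le> (\<Sum>i=1..j. w i) then max ((\<Sum>i=1..n. w i) - x) 0 else 0)"
    for w :: "nat \<Rightarrow> real"
  have [measurable]: "(\<lambda>w. \<Sum>i=1..j. w i) \<in> borel_measurable (PiM {1..n} (\<lambda>_. borel :: real measure))"
    if "j \<le> n" for j
    using that by (intro borel_measurable_sum measurable_component_singleton) auto
  have "f \<in> borel_measurable (PiM {1..n} (\<lambda>_. borel))"
    unfolding f_def[abs_def]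
    by (intro measurable_If borel_measurable_max borel_measurable_diff borel_measurable_const
        predE pred_intros_finite finite_atLeastAtMost) (auto simp: pred_def)
  from indep_var_past_next[OF this]
  have "indep_var borel (\<lambda>\<omega>. f (\<lambda>i\<in>{1..n}. X i \<omega>)) borel (X (Suc n))" .
  define Z where "Z \<omega> = f (\<lambda>i\<in>{1..n}. X i \<omega>)" for \<omega>
  have Z: "Z \<omega> = ?I n \<omega> * max (S n \<omega> - x) 0" if "\<omega> \<in> space M" for \<omega>
    using that by (auto simp: Z_def f_def exceed_def S_def indicator_def)
  have ind: "indep_var borel Z borel (X (Suc n))"
    unfolding Z_def by fact
  have Z_int: "integrable M Z"
    using integrable_mult_indicator[OF exceed_sets integrable_pos_part_S, of u n n x]
    by (subst Bochner_Integration.integrable_cong[OF refl Z]) auto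
  have X: "integrable M (X (Suc n))" "expectation (X (Suc n)) = 0"
    using integrable_X expectation_X by auto
  have ZX: "integrable M (\<lambda>\<omega>. Z \<omega> * X (Suc n) \<omega>)" "expectation (\<lambda>\<omega>. Z \<omega> * X (Suc n) \<omega>) = 0"
    using indep_var_integrable[OF ind Z_int X(1)] indep_var_lebesgue_integral[OF ind Z_int X(1)] X(2)
    by auto
  have I_int: "integrable M (?I k)" for k
    by (rule integrable_real_indicator) (auto simp: emeasure_eq_measure)
  have IS_int: "integrable M (\<lambda>\<omega>. ?I k \<omega> * (max (S k \<omega> - x) 0)\<^sup>2)" for k
    using integrable_mult_indicator[OF exceed_sets integrable_pos_part_S_sq, of u k k x] by simp
  \<comment> \<open>The first two terms are the tangent bound on paths that have already crossed.
    The last one charges \<open>(u - x)^2\<close> to paths crossing exactly at time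
    \<open>Suc n\<close>.\<close>
  have "expectation (\<lambda>\<omega>. ?I n \<omega> * (max (S n \<omega> - x) 0)\<^sup>2 + 2 * (Z \<omega> * X (Suc n) \<omega>)
        + (u - x)\<^sup>2 * (?I (Suc n) \<omega> - ?I n \<omega>))
      \<le> expectation (\<lambda>\<omega>. ?I (Suc n) \<omega> * (max (S (Suc n) \<omega> - x) 0)\<^sup>2)"
  proof (intro integral_mono Bochner_Integration.integrable_add integrable_mult_right
      Bochner_Integration.integrable_diff IS_int I_int ZX)
    fix \<omega> assume \<omega>: "\<omega> \<in> space M"
    show "?I n \<omega> * (max (S n \<omega> - x) 0)\<^sup>2 + 2 * (Z \<omega> * X (Suc n) \<omega>)
        + (u - x)\<^sup>2 * (?I (Suc n) \<omega> - ?I n \<omega>) \<le> ?I (Suc n) \<omega> * (max (S (Suc n) \<omega> - x) 0)\<^sup>2"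
    proof (cases "\<omega> \<in> exceed u n")
      case True
      then have "\<omega> \<in> exceed u (Suc n)"
        by (fastforce simp: exceed_def)
      moreover have "(max a 0)\<^sup>2 + 2 * (max a 0 * b) \<le> (max (a + b) 0)\<^sup>2" for a b :: real
      proof -
        consider "a \<le> 0" | "0 \<le> a" "0 \<le> a + b" | "0 \<le> a" "a + b \<le> 0"
          by linarith
        then show ?thesis
        proof cases
          case 2
          have "0 \<le> b\<^sup>2" by simp
          with 2 show ?thesis by (simp add: power2_eq_square algebra_simps)
        next
          case 3
          then have "a * (a + b) \<le> 0" "0 \<le> a * a"
            by (auto intro: mult_nonneg_nonpos)
          then have "a\<^sup>2 + 2 * (a * b) \<le> 0"
            unfolding power2_eq_square distrib_left by linarith
          with 3 show ?thesis by simp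
        qed simp
      qed
      from this[of "S n \<omega> - x" "X (Suc n) \<omega>"] True
      have "(max (S n \<omega> - x) 0)\<^sup>2 + 2 * (max (S n \<omega> - x) 0 * X (Suc n) \<omega>) \<le> (max (S (Suc n) \<omega> - x) 0)\<^sup>2"
        by (simp add: S_Suc algebra_simps)
      ultimately show ?thesis
        using True \<omega> by (simp add: Z)
    next
      case False
      show ?thesis
      proof (cases "\<omega> \<in> exceed u (Suc n)")
        case True
        then have "u \<le> S (Suc n) \<omega>"
          using False by (auto simp: exceed_def le_Suc_eq)
        then have "(u - x)\<^sup>2 \<le> (max (S (Suc n) \<omega> - x) 0)\<^sup>2"
          using assms by (intro power_mono) auto
        then show ?thesis
          using False True \<omega> by (simp add: Z)
      qed (use False \<omega> in \<open>simp add: Z\<close>)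
    qed
  qed
  also have "expectation (\<lambda>\<omega>. ?I n \<omega> * (max (S n \<omega> - x) 0)\<^sup>2 + 2 * (Z \<omega> * X (Suc n) \<omega>)
        + (u - x)\<^sup>2 * (?I (Suc n) \<omega> - ?I n \<omega>)) =
      expectation (\<lambda>\<omega>. ?I n \<omega> * (max (S n \<omega> - x) 0)\<^sup>2)
        + (u - x)\<^sup>2 * (prob (exceed u (Suc n)) - prob (exceed u n))"
    using ZX IS_int I_int by simp
  finally show ?case
    using Suc by (simp add: algebra_simps)
qed

section \<open>Exceedance probability at the threshold\<close>

lemma prob_exceed_le_P2_tilde: "prob (exceed u n) \<le> P2_tilde n A B u"
  unfolding P2_tilde_def
proof (rule cINF_greatest)
  fix x assume "x \<in> {..<u}"
  then have x: "x < u" by simp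
  have "(u - x)\<^sup>2 * prob (exceed u n) \<le>
      expectation (\<lambda>\<omega>. indicator (exceed u n) \<omega> * (max (S n \<omega> - x) 0)\<^sup>2)"
    by (rule exceed_prob_le[OF x])
  also have "\<dots> \<le> expectation (\<lambda>\<omega>. (max (S n \<omega> - x) 0)\<^sup>2)"
    by (intro integral_mono' integrable_pos_part_S_sq) (auto simp: indicator_def)
  also have "\<dots> \<le> G_tail n A B x"
    by (rule expectation_pos_part_S_le)
  finally show "prob (exceed u n) \<le>
      measure_pmf.expectation (G_sum_pmf n A B) (\<lambda>s. (max (s - x) 0)\<^sup>2) / (max (u - x) 0)\<^sup>2"
    using x by (simp add: G_tail_def max_def pos_le_divide_eq mult.commute)
qed auto

lemma AE_S_le: "AE \<omega> in M. S n \<omega> \<le> real n * B"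
proof (induction n)
  case (Suc n)
  have "AE \<omega> in M. X (Suc n) \<omega> \<le> B"
    by (rule AE_X_le) simp
  with Suc show ?case
    by eventually_elim (simp add: S_Suc algebra_simps)
qed (simp add: S_def)

text \<open>If the top atom has mass at most \<open>\<delta>\<close>, then \<open>P2_tilde\<close>
  equals \<open>\<delta>\<close> at the threshold. Otherwise the threshold is out of reach almost
  surely.\<close>

lemma prob_exceed_q_threshold_le:
  assumes "0 \<le> \<delta>" "\<delta> < 1"
  shows "prob (exceed (q_threshold \<delta> n A B) n) \<le> \<delta>"
proof (cases "measure_pmf.prob (G_sum_pmf n A B) {real n * B} \<le> \<delta>")
  case True
  then show ?thesis
    using prob_exceed_le_P2_tilde P2_tilde_q_threshold[OF True \<open>\<delta> < 1\<close>] by metis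
next
  case False
  then have q: "q_threshold \<delta> n A B = real n * B + 1"
    by (simp add: q_threshold_def)
  have "AE \<omega> in M. \<forall>j\<in>{1..n}. S j \<omega> \<le> real j * B"
    by (intro AE_finite_allI AE_S_le) auto
  then have "AE \<omega> in M. \<omega> \<notin> exceed (real n * B + 1) n"
  proof eventually_elim
    case (elim \<omega>)
    \<comment> \<open>The summand \<open>1\<close> in the threshold makes this strict even when
      \<open>S j\<close> attains its almost sure bound.\<close>
    have "S j \<omega> < real n * B + 1" if "j \<in> {1..n}" for j
    proof -
      have "real j * B \<le> real n * B"
        using that B_pos by (intro mult_right_mono) auto
      then show ?thesis using elim that by fastforce
    qed
    then show ?case by (force simp: exceed_def not_le)
  qed
  then have "prob (exceed (real n * B + 1) n) = 0"
    by (intro prob_eq_0[THEN iffD2]) auto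
  then show ?thesis
    using assms by (simp add: q)
qed

end

section \<open>Blocks\<close>

text \<open>The bound is part of the condition under \<open>LEAST\<close> once some \<open>k\<close>
  satisfies it; the exponent just below the first power of \<open>\<eta>\<close> exceeding
  \<open>n\<close> does.\<close>

lemma le_block_end:
  assumes "\<eta> > 1" "n \<ge> 1"
  shows "n \<le> block_end \<eta> n"
proof -
  obtain N where N: "real n < \<eta> ^ N"
    using real_arch_pow[OF assms(1)] by blast
  define N' where "N' = (LEAST N. real n < \<eta> ^ N)"
  have N': "real n < \<eta> ^ N'" "\<And>k. k < N' \<Longrightarrow> \<eta> ^ k \<le> real n"
    using LeastI[of "\<lambda>N. real n < \<eta> ^ N", OF N] not_less_Least[of _ "\<lambda>N. real n < \<eta> ^ N"]
    by (auto simp: N'_def not_less)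
  \<comment> \<open>\<open>N'\<close> is not \<open>0\<close>, because
    \<open>\<eta> ^ 0 = 1 <= n\<close>.\<close>
  then obtain k where "N' = Suc k"
    using assms by (cases N') auto
  then have "\<lceil>\<eta> ^ k\<rceil> \<le> int n \<and> int n \<le> \<lfloor>\<eta> ^ (k + 1)\<rfloor>"
    using N' by (auto simp: ceiling_le_iff le_floor_iff less_imp_le)
  then have "int n \<le> \<lfloor>\<eta> ^ (block_index \<eta> n + 1)\<rfloor>"
    unfolding block_index_def by (rule LeastI2) auto
  then show ?thesis
    by (simp add: block_end_def)
qed

theorem theorem2:
  fixes M :: "'a measure" and X :: "nat \<Rightarrow> 'a \<Rightarrow> real" and A :: "nat \<Rightarrow> real"
    and B \<eta> \<delta> :: real and h :: "real \<Rightarrow> real"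
  assumes "prob_space M"
    and "B > 0"
    and "\<And>i. i \<ge> 1 \<Longrightarrow> A i > 0"
    and "prob_space.indep_vars M (\<lambda>_. borel) X {1..}"
    and "\<And>i. i \<ge> 1 \<Longrightarrow> integrable M (X i)"
    and "\<And>i. i \<ge> 1 \<Longrightarrow> prob_space.expectation M (X i) = 0"
    and "\<And>i. i \<ge> 1 \<Longrightarrow> integrable M (\<lambda>\<omega>. (X i \<omega>)\<^sup>2)"
    and "\<And>i. i \<ge> 1 \<Longrightarrow> prob_space.variance M (X i) \<le> (A i)\<^sup>2"
    and "\<And>i. i \<ge> 1 \<Longrightarrow> prob_space.prob M {\<omega> \<in> space M. X i \<omega> > B} = 0"
    and "\<eta> > 1"
    and "\<And>x. x \<ge> 0 \<Longrightarrow> h x > 0"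
    and "summable (\<lambda>k::nat. 1 / h (real k))"
    and "(\<Sum>k::nat. 1 / h (real k)) \<le> 1"
    and "0 \<le> \<delta>" and "\<delta> \<le> 1"
  shows "prob_space.prob M {\<omega> \<in> space M. \<exists>n\<ge>1. (\<Sum>i=1..n. X i \<omega>)
           \<ge> q_threshold (\<delta> / h (real (block_index \<eta> n))) (block_end \<eta> n) A B} \<le> \<delta>"
proof -
  interpret prob_space M by fact
  interpret bounded_summands M A B X
  proof (unfold_locales, goal_cases)
    \<comment> \<open>This goal is \<open>AE_X_le\<close>: the null event \<open>X i > B\<close> is
      turned into an almost sure bound.\<close>
    case (8 i)
    have "X i \<in> borel_measurable M"
      using assms(5) 8 by auto
    then have "AE \<omega> in M. \<not> B < X i \<omega>"
      using assms(9)[OF 8] by (subst AE_iff_measurable[OF _ refl]) (auto simp: emeasure_eq_measure)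
    then show ?case by (simp add: not_less)
  qed (use assms in auto)
  define w where "w k = 1 / h (real k)" for k :: nat
  define c where "c k = nat \<lfloor>\<eta> ^ (k + 1)\<rfloor>" for k
  define E where "E k = exceed (q_threshold (\<delta> * w k) (c k) A B) (c k)" for k
  have w_pos: "0 < w k" for k
    using assms(11) by (simp add: w_def)
  have w_sum: "summable w" "suminf w \<le> 1"
    using assms(12,13) by (simp_all add: w_def[abs_def])
  \<comment> \<open>Two consecutive positive weights sum to at most \<open>1\<close>, so each is
    strictly smaller. Hence \<open>\<delta> * w k < 1\<close> even for
    \<open>\<delta> = 1\<close>.\<close>
  have w_less: "w k < 1" for k
  proof -
    have "sum w {k, Suc k} \<le> suminf w"
      using w_sum(1) w_pos by (intro sum_le_suminf) (auto intro: less_imp_le)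
    then show ?thesis
      using w_sum(2) w_pos[of "Suc k"] by simp
  qed
  have prob_E: "prob (E k) \<le> \<delta> * w k" for k
  proof -
    have "\<delta> * w k \<le> 1 * w k"
      using assms(15) w_pos[of k] by (intro mult_right_mono) auto
    then show ?thesis
      unfolding E_def using assms(14) w_pos[of k] w_less[of k]
      by (intro prob_exceed_q_threshold_le mult_nonneg_nonneg) linarith+
  qed
  have \<delta>w: "summable (\<lambda>k. \<delta> * w k)"
    using w_sum(1) by (rule summable_mult)
  have E_sum: "summable (\<lambda>k. prob (E k))"
    using prob_E by (intro summable_comparison_test_ev[OF _ \<delta>w]) simp
  \<comment> \<open>The threshold at time \<open>n\<close> depends on \<open>n\<close> only through
    its block \<open>k\<close>, and \<open>n <= c k\<close>, so a crossing at time \<open>n\<close>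
    lies in \<open>E k\<close>.\<close>
  have "{\<omega> \<in> space M. \<exists>n\<ge>1. (\<Sum>i=1..n. X i \<omega>)
           \<ge> q_threshold (\<delta> / h (real (block_index \<eta> n))) (block_end \<eta> n) A B} \<subseteq> (\<Union>k. E k)"
  proof
    fix \<omega> assume "\<omega> \<in> {\<omega> \<in> space M. \<exists>n\<ge>1. (\<Sum>i=1..n. X i \<omega>)
           \<ge> q_threshold (\<delta> / h (real (block_index \<eta> n))) (block_end \<eta> n) A B}"
    then obtain n where n: "\<omega> \<in> space M" "n \<ge> 1"
      "q_threshold (\<delta> / h (real (block_index \<eta> n))) (block_end \<eta> n) A B \<le> S n \<omega>"
      by (auto simp: S_def)
    then have "\<omega> \<in> E (block_index \<eta> n)"
      using le_block_end[OF assms(10) n(2)]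
      by (auto simp: E_def exceed_def w_def c_def block_end_def)
    then show "\<omega> \<in> (\<Union>k. E k)" by blast
  qed
  then have "prob {\<omega> \<in> space M. \<exists>n\<ge>1. (\<Sum>i=1..n. X i \<omega>)
           \<ge> q_threshold (\<delta> / h (real (block_index \<eta> n))) (block_end \<eta> n) A B} \<le> prob (\<Union>k. E k)"
    by (intro finite_measure_mono) (auto simp: E_def)
  also have "\<dots> \<le> (\<Sum>k. prob (E k))"
    using E_sum by (intro finite_measure_subadditive_countably) (auto simp: E_def)
  also have "\<dots> \<le> (\<Sum>k. \<delta> * w k)"
    using prob_E E_sum \<delta>w by (rule suminf_le)
  also have "\<dots> = \<delta> * suminf w"
    using w_sum(1) by (rule suminf_mult)
  also have "\<dots> \<le> \<delta> * 1"
    using assms(14) w_sum(2) by (rule mult_left_mono[rotated])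
  finally show ?thesis by simp
qed

end
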